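(* Let $n$ be even and let $0 \le a, b < n$ with $a \ne b$. Then $T_1(n,a,b)$ is a nut graph if and only if (i) $\gcd\left(\frac{n}{2}, a\right) = \gcd\left(\frac{n}{2}, b\right) = 1$; (ii) $a \not\equiv \frac{n}{2} \pmod 2$ and $b \not\equiv \frac{n}{2} \pmod 2$; (iii) $v_2(b-a) \ge v_2(n)$.
   Context: All graphs are simple. A nut graph is a graph whose adjacency matrix has the eigenvalue $0$ with multiplicity one (nullity one) and whose null space is spanned by a vector with no zero entries. For $n$ even, $T_1(n,a,b)$ is the graph with vertex set $\{x_j, y_j, z_j : j \in \mathbb{Z}_n\}$ (indices modulo $n$) and edge set $\{x_j y_{j+a}, x_j y_{j+b}, x_j z_j, y_j z_j, z_j z_{j+n/2} : j \in \mathbb{Z}_n\}$. For a nonzero integer $x$, $v_2(x)$ denotes the exponent of $2$ in the prime factorization of $|x|$. *)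

theory Defs
  imports "Jordan_Normal_Form.Matrix_Kernel" "HOL-Number_Theory.Cong"
begin

text \<open>A graph is a pair of a vertex set and a set of unordered pairs of vertices.\<close>

type_synonym 'v graph = "'v set \<times> 'v set set"

definition simple_graph :: "'v graph \<Rightarrow> bool" where
  "simple_graph G \<longleftrightarrow>
     finite (fst G) \<and> snd G \<subseteq> {{u, v} | u v. u \<in> fst G \<and> v \<in> fst G \<and> u \<noteq> v}"

text \<open>The adjacency matrix with respect to an enumeration \<open>vs\<close> of the vertices.\<close>

definition adjacency_matrix :: "'v graph \<Rightarrow> 'v list \<Rightarrow> real mat" where
  "adjacency_matrix G vs =
     mat (length vs) (length vs) (\<lambda>(i, j). if {vs ! i, vs ! j} \<in> snd G then 1 else 0)"

text \<open>
  Changing the enumeration of the vertices conjugates the adjacency matrix by a permutation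
  matrix, which affects neither the nullity nor the existence of a kernel vector as below;
  hence one may equivalently quantify over some or over all enumerations. The multiplicity of
  the eigenvalue 0 is the nullity of the (real symmetric) adjacency matrix.
\<close>

definition nut_graph :: "'v graph \<Rightarrow> bool" where
  "nut_graph G \<longleftrightarrow> simple_graph G \<and>
     (\<exists>vs. distinct vs \<and> set vs = fst G \<and>
        (let A = adjacency_matrix G vs in
           kernel_dim A = 1 \<and>
           (\<exists>w \<in> carrier_vec (length vs).
              mat_kernel A = {c \<cdot>\<^sub>v w | c. True} \<and>
              (\<forall>i < length vs. w $ i \<noteq> 0))))"

datatype T1_vertex = X nat | Y nat | Z nat

text \<open>The indices in \<open>\<int>\<^sub>n\<close> are represented by the residues \<open>0, \<dots>, n - 1\<close>.\<close>

definition T1 :: "nat \<Rightarrow> nat \<Rightarrow> nat \<Rightarrow> T1_vertex graph" where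
  "T1 n a b =
     ((\<Union>j<n. {X j, Y j, Z j}),
      (\<Union>j<n. {{X j, Y ((j + a) mod n)}, {X j, Y ((j + b) mod n)}, {X j, Z j}, {Y j, Z j},
                {Z j, Z ((j + n div 2) mod n)}}))"

end

theory Submission
  imports Defs
begin

text \<open>
  Let \<open>S\<close> be the shift on \<open>n\<close>-periodic sequences and put \<open>p = S\<^sup>a\<close>, \<open>q = S\<^sup>b\<close>,
  \<open>E = S\<^sup>m\<close> with \<open>m = n/2\<close>. Eliminating \<open>x\<close> and \<open>y\<close> from the kernel
  equations \<open>(p + q) y = - z\<close>, \<open>(1/p + 1/q) x = - z\<close>, \<open>x + y = - E z\<close> leaves an operator
  which, since \<open>E\<^sup>2 = 1\<close>, is a unit times \<open>(p + q) (p - E) (q - E)\<close>. Constant sequences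
  always yield the kernel vector \<open>(1, 1, -2)\<close>; there is no other one up to scaling precisely
  when \<open>p + q\<close> is injective, which is the condition on \<open>2\<close>-adic valuations, and
  \<open>p - E\<close>, \<open>q - E\<close> annihilate only constants, i.e. \<open>a - m\<close> and \<open>b - m\<close> are coprime
  to \<open>n\<close>.
\<close>

section \<open>Kernel vectors as functions on the vertices\<close>

text \<open>Functions on the vertices replace coordinate vectors, so that no enumeration has to be
  carried along. Only the values on \<open>fst G\<close> matter.\<close>

definition kernel_function :: "'v graph \<Rightarrow> ('v \<Rightarrow> real) \<Rightarrow> bool" where
  "kernel_function G f \<longleftrightarrow> (\<forall>v\<in>fst G. (\<Sum>u\<in>{u\<in>fst G. {v, u} \<in> snd G}. f u) = 0)"

lemma vec_in_kernel_adjacency_matrix: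
  assumes "distinct vs" "set vs = fst G"
  shows "vec (length vs) (\<lambda>i. f (vs ! i)) \<in> mat_kernel (adjacency_matrix G vs)
    \<longleftrightarrow> kernel_function G f"
proof -
  let ?k = "length vs"
  let ?w = "vec ?k (\<lambda>i. f (vs ! i))"
  let ?A = "adjacency_matrix G vs"
  have fin: "finite (fst G)"
    using assms(2) by (metis List.finite_set)
  have entry: "(?A *\<^sub>v ?w) $ i = (\<Sum>u\<in>{u\<in>fst G. {vs ! i, u} \<in> snd G}. f u)" if "i < ?k" for i
  proof -
    have "(?A *\<^sub>v ?w) $ i = (\<Sum>j<?k. if {vs ! i, vs ! j} \<in> snd G then f (vs ! j) else 0)"
      using that by (auto simp: adjacency_matrix_def scalar_prod_def lessThan_atLeast0 intro!: sum.cong)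
    also have "\<dots> = (\<Sum>u\<in>fst G. if {vs ! i, u} \<in> snd G then f u else 0)"
      using sum.reindex_bij_betw[OF bij_betw_nth[OF assms(1) refl assms(2)[symmetric]],
          of "\<lambda>u. if {vs ! i, u} \<in> snd G then f u else 0"] .
    also have "\<dots> = (\<Sum>u\<in>{u\<in>fst G. {vs ! i, u} \<in> snd G}. f u)"
      using fin by (simp add: sum.inter_filter)
    finally show ?thesis .
  qed
  have "?w \<in> mat_kernel ?A \<longleftrightarrow> (\<forall>i<?k. (?A *\<^sub>v ?w) $ i = 0)"
    by (auto simp: mat_kernel_def vec_eq_iff adjacency_matrix_def)
  also have "\<dots> \<longleftrightarrow> kernel_function G f"
    unfolding kernel_function_def assms(2)[symmetric] all_set_conv_all_nth
    using entry assms(2) by auto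
  finally show ?thesis .
qed

text \<open>An enumeration of the vertices turns vectors into functions and back, so the same
  spanning condition is read on both sides. For the converse, \<open>nonempty\<close> makes the full
  vector \<open>w\<close> nonzero, hence \<open>{w}\<close> is a basis of the kernel and its
  dimension is one.\<close>

lemma nut_graph_iff_kernel_function:
  assumes simple: "simple_graph G" and nonempty: "fst G \<noteq> {}"
  shows "nut_graph G \<longleftrightarrow>
    (\<exists>g. kernel_function G g \<and> (\<forall>v\<in>fst G. g v \<noteq> 0) \<and>
      (\<forall>f. kernel_function G f \<longrightarrow> (\<exists>c. \<forall>v\<in>fst G. f v = c * g v)))"
    (is "_ \<longleftrightarrow> ?R")
proof
  assume "nut_graph G"
  then obtain vs w where vs: "distinct vs" "set vs = fst G"
    and w: "w \<in> carrier_vec (length vs)" "\<And>i. i < length vs \<Longrightarrow> w $ i \<noteq> 0"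
    and ker: "mat_kernel (adjacency_matrix G vs) = {c \<cdot>\<^sub>v w | c. True}"
    unfolding nut_graph_def Let_def by auto
  have bij: "bij_betw ((!) vs) {..<length vs} (fst G)"
    using bij_betw_nth[OF vs(1) refl vs(2)[symmetric]] .
  \<comment> \<open>The coordinates of \<open>w\<close> are carried to the vertices along the
    inverse of the enumeration.\<close>
  define g where "g v = w $ (the_inv_into {..<length vs} ((!) vs) v)" for v
  have g: "g (vs ! i) = w $ i" if "i < length vs" for i
    using that bij by (simp add: g_def the_inv_into_f_f bij_betw_def)
  have "vec (length vs) (\<lambda>i. g (vs ! i)) = 1 \<cdot>\<^sub>v w"
    using w(1) by (intro eq_vecI) (auto simp: g)
  then have "kernel_function G g"
    unfolding vec_in_kernel_adjacency_matrix[OF vs, symmetric] ker by blast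
  moreover have "\<forall>v\<in>fst G. g v \<noteq> 0"
    unfolding vs(2)[symmetric] all_set_conv_all_nth using g w(2) by simp
  moreover have "\<exists>c. \<forall>v\<in>fst G. f v = c * g v" if "kernel_function G f" for f
  proof -
    from that obtain c where c: "vec (length vs) (\<lambda>i. f (vs ! i)) = c \<cdot>\<^sub>v w"
      unfolding vec_in_kernel_adjacency_matrix[OF vs, symmetric] ker by blast
    have "f (vs ! i) = c * g (vs ! i)" if "i < length vs" for i
      using arg_cong[OF c, of "\<lambda>v. v $ i"] that w(1) by (simp add: g)
    then show ?thesis
      unfolding vs(2)[symmetric] all_set_conv_all_nth by blast
  qed
  ultimately show ?R by blast
next
  assume ?R
  then obtain g where g: "kernel_function G g" "\<And>v. v \<in> fst G \<Longrightarrow> g v \<noteq> 0"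
    and span: "\<And>f. kernel_function G f \<Longrightarrow> \<exists>c. \<forall>v\<in>fst G. f v = c * g v" by blast
  obtain vs where vs: "distinct vs" "set vs = fst G"
    using simple finite_distinct_list unfolding simple_graph_def by blast
  let ?k = "length vs"
  let ?A = "adjacency_matrix G vs"
  define w where "w = vec ?k (\<lambda>i. g (vs ! i))"
  have w: "w \<in> carrier_vec ?k" "\<And>i. i < ?k \<Longrightarrow> w $ i \<noteq> 0"
    using g(2) vs(2) nth_mem by (fastforce simp: w_def)+
  have A: "?A \<in> carrier_mat ?k ?k"
    by (simp add: adjacency_matrix_def)
  interpret kernel ?k ?k ?A
    by (rule kernel.intro[OF A])
  have wker: "w \<in> mat_kernel ?A"
    unfolding w_def vec_in_kernel_adjacency_matrix[OF vs] by (rule g(1))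
  have multiple: "\<exists>c. u = c \<cdot>\<^sub>v w" if u: "u \<in> mat_kernel ?A" for u
  proof -
    define f where "f v = u $ (the_inv_into {..<?k} ((!) vs) v)" for v
    have f: "f (vs ! i) = u $ i" if "i < ?k" for i
      using that bij_betw_nth[OF vs(1) refl vs(2)[symmetric]]
      by (simp add: f_def the_inv_into_f_f bij_betw_def)
    have dim: "u \<in> carrier_vec ?k"
      using mat_kernelD[OF A u] by simp
    then have "vec ?k (\<lambda>i. f (vs ! i)) = u"
      by (intro eq_vecI) (auto simp: f)
    then have "kernel_function G f"
      unfolding vec_in_kernel_adjacency_matrix[OF vs, symmetric] using u by simp
    then obtain c where "\<forall>v\<in>fst G. f v = c * g v"
      using span by blast
    then have "u $ i = c * g (vs ! i)" if "i < ?k" for i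
      using f that nth_mem[OF that] vs(2) by auto
    then have "u = c \<cdot>\<^sub>v w"
      using dim by (intro eq_vecI) (auto simp: w_def)
    then show ?thesis ..
  qed
  have "0 < ?k"
    using vs(2) nonempty by auto
  then have "w \<noteq> 0\<^sub>v ?k"
    using w(2)[of 0] by auto
  moreover have "span {w} = mat_kernel ?A"
  proof
    show "span {w} \<subseteq> mat_kernel ?A"
      using Ker.span_is_subset2[of "{w}"] wker by simp
    have "submodule class_ring (span {w}) VK"
      using Ker.span_is_submodule[of "{w}"] wker by simp
    then have "c \<cdot>\<^sub>v w \<in> span {w}" for c
      using submodule.smult_closed[of class_ring "span {w}" VK c w] Ker.in_own_span[of "{w}"] wker
      by (simp add: class_ring_simps)
    then show "mat_kernel ?A \<subseteq> span {w}"
      using multiple by blast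
  qed
  ultimately have "dim = 1"
    using wker by (intro Ker.dim1I[of w]) simp_all
  then have "kernel_dim ?A = 1"
    by simp
  moreover have "mat_kernel ?A = {c \<cdot>\<^sub>v w | c. True}"
    using multiple mat_kernel_smult[OF A wker] by blast
  ultimately show "nut_graph G"
    unfolding nut_graph_def Let_def using simple vs w by blast
qed

section \<open>Periodic sequences on the integers\<close>

definition periodic :: "int \<Rightarrow> (int \<Rightarrow> real) \<Rightarrow> bool" where
  "periodic n f \<longleftrightarrow> (\<forall>j. f (j + n) = f j)"

lemma periodic_mult:
  assumes "periodic n f"
  shows "f (j + k * n) = f j"
proof -
  have nat: "f (i + int l * n) = f i" for i l
  proof (induction l)
    case (Suc l)
    have "f (i + int (Suc l) * n) = f ((i + int l * n) + n)"
      by (simp add: algebra_simps)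
    also have "\<dots> = f i"
      using assms Suc by (simp add: periodic_def)
    finally show ?case .
  qed simp
  show ?thesis
  proof (cases "k \<ge> 0")
    case True
    then show ?thesis using nat[of j "nat k"] by simp
  next
    case False
    then show ?thesis using nat[of "j + k * n" "nat (- k)"] by simp
  qed
qed

lemma periodic_mod: "periodic n f \<Longrightarrow> f (j mod n) = f j"
  using periodic_mult[of n f "j mod n" "j div n"] by simp

text \<open>\<open>\<bar>w\<bar> * t\<close> is a multiple of \<open>n\<close>, so this many steps
  of length \<open>t\<close> return to the start. As \<open>w\<close> is odd, they also change the
  sign of the value, which must therefore be 0.\<close>

lemma antiperiodic_periodic_zero:
  assumes "periodic n f" and anti: "\<And>j. f (j + t) = - f j"
    and n: "n = 2 ^ v * w" and "odd w" and "2 ^ v dvd t"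
  shows "f j = 0"
proof -
  have rep: "f (i + int k * t) = (-1) ^ k * f i" for i k
  proof (induction k)
    case (Suc k)
    have "f (i + int (Suc k) * t) = f ((i + int k * t) + t)"
      by (simp add: algebra_simps)
    then show ?case using Suc anti[of "i + int k * t"] by simp
  qed simp
  obtain u where u: "t = 2 ^ v * u"
    using assms(5) by auto
  define k where "k = nat \<bar>w\<bar>"
  have "int k = w * sgn w"
    by (simp add: k_def flip: abs_sgn)
  then have "int k * t = (sgn w * u) * n"
    by (simp add: n u)
  then have "f (j + int k * t) = f j"
    using periodic_mult[OF assms(1)] by simp
  moreover have "odd k"
    using assms(4) by (simp add: k_def even_nat_iff)
  ultimately show ?thesis
    using rep[of j k] by simp
qed

text \<open>After \<open>n\<close> steps of length \<open>d\<close> the value has grown by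
  \<open>n * c\<close> and is the old one by periodicity, so \<open>c = 0\<close>. Then
  \<open>n\<close> and \<open>d\<close> are both periods, and by Bezout so is 1.\<close>

lemma periodic_arithmetic_progression_constant:
  assumes per: "periodic n f" and "n > 0" and "coprime n d"
    and step: "\<And>j. f (j + d) = f j + c"
  shows "f i = f j"
proof -
  have rep: "f (i + int k * d) = f i + real k * c" for i k
  proof (induction k)
    case (Suc k)
    have "f (i + int (Suc k) * d) = f ((i + int k * d) + d)"
      by (simp add: algebra_simps)
    then show ?case using Suc step[of "i + int k * d"] by (simp add: algebra_simps)
  qed simp
  have "f (0 + int (nat n) * d) = f 0"
    using periodic_mult[OF per, of 0 d] \<open>n > 0\<close> by (simp add: mult.commute)
  then have "c = 0"
    using rep[of 0 "nat n"] \<open>n > 0\<close> by simp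
  then have d: "periodic d f"
    using step by (simp add: periodic_def)
  obtain k l where kl: "k * n + l * d = 1"
    using assms(3) bezout_int[of n d] by auto
  have "f i = f (j + (i - j) * (k * n + l * d))"
    by (simp add: kl)
  also have "\<dots> = f ((j + ((i - j) * k) * n) + ((i - j) * l) * d)"
    by (simp add: algebra_simps)
  also have "\<dots> = f j"
    by (simp only: periodic_mult[OF d] periodic_mult[OF per])
  finally show ?thesis .
qed

section \<open>The kernel equations for periodic sequences\<close>

text \<open>With \<open>m = n/2\<close>, the three equations are the kernel conditions at
  \<open>X j\<close>, \<open>Y j\<close> and \<open>Z j\<close>. Indexing by all integers makes
  backward shifts plain subtractions.\<close>

definition kernel_triple ::
  "int \<Rightarrow> int \<Rightarrow> int \<Rightarrow> (int \<Rightarrow> real) \<Rightarrow> (int \<Rightarrow> real) \<Rightarrow> (int \<Rightarrow> real) \<Rightarrow> bool" where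
  "kernel_triple m a b x y z \<longleftrightarrow>
    periodic (2 * m) x \<and> periodic (2 * m) y \<and> periodic (2 * m) z \<and>
    (\<forall>j. y (j + a) + y (j + b) + z j = 0) \<and>
    (\<forall>j. x (j - a) + x (j - b) + z j = 0) \<and>
    (\<forall>j. x j + y j + z (j + m) = 0)"

text \<open>Elimination gives (p + q) (p - E) (q - E) z = 0. The first factor is cancelled by the
  valuation condition, the other two by coprimality, so \<open>z\<close> is constant. Then
  \<open>x\<close> and \<open>y\<close> follow from injectivity of p + q.\<close>

lemma kernel_triple_determined:
  assumes triple: "kernel_triple m a b x y z" and "m > 0"
    and val: "2 * m = 2 ^ v * w" "odd w" "2 ^ v dvd b - a"
    and cop: "coprime (2 * m) (a - m)" "coprime (2 * m) (b - m)"
  shows "x j = - z 0 / 2 \<and> y j = - z 0 / 2 \<and> z j = z 0"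
proof -
  have px: "periodic (2 * m) x" and py: "periodic (2 * m) y" and pz: "periodic (2 * m) z"
    and eq: "y (j + a) + y (j + b) + z j = 0" "x (j - a) + x (j - b) + z j = 0"
      "x j + y j + z (j + m) = 0" for j
    using triple by (auto simp: kernel_triple_def)
  have vanish: "f j = 0"
    if "periodic (2 * m) f" and f: "\<And>j. f (j + a) + f (j + b) = 0" for f and j
  proof (rule antiperiodic_periodic_zero[OF that(1) _ val])
    show "f (j + (b - a)) = - f j" for j
      using f[of "j - a"] by (simp add: algebra_simps)
  qed
  have shift: "z (j + 2 * m + s) = z (j + s)" for j s
    using pz unfolding periodic_def by (metis add.commute add.assoc)
  \<comment> \<open>\<open>h = (p - E) (q - E) z\<close> and then \<open>k = (q - E) z\<close>, in the notation above.\<close>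
  define h where "h j = z (j + a + b) - z (j + a + m) - z (j + b + m) + z j" for j
  have "periodic (2 * m) h"
    using shift[of _ "a + b"] shift[of _ "a + m"] shift[of _ "b + m"] shift[of _ 0]
    by (simp add: periodic_def h_def add.assoc)
  \<comment> \<open>The sum of the first four equations minus the third one at
    \<open>j + 2 * a\<close>, twice at \<open>j + a + b\<close>, and at \<open>j + 2 * b\<close>:
    all terms in \<open>x\<close> and \<open>y\<close> cancel. In operators, (p + q)^2 is applied to
    x + y = - E z.\<close>
  moreover have "h (j + a) + h (j + b) = 0" for j
    using eq(1)[of "j + a"] eq(1)[of "j + b"]
      eq(2)[of "j + 2 * a + b"] eq(2)[of "j + a + 2 * b"]
      eq(3)[of "j + 2 * a"] eq(3)[of "j + a + b"] eq(3)[of "j + 2 * b"]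
    by (simp add: h_def algebra_simps)
  ultimately have h0: "h j = 0" for j
    by (rule vanish)
  define k where "k j = z (j + b) - z (j + m)" for j
  have "periodic (2 * m) k"
    unfolding periodic_def k_def shift by simp
  \<comment> \<open>This is (p - E) k = 0 read at \<open>j - m\<close>, with
    \<open>z (j - m) = z (j + m)\<close>.\<close>
  moreover have "k (j + (a - m)) = k j + 0" for j
    using h0[of "j - m"] pz[unfolded periodic_def, rule_format, of "j - m"]
    by (simp add: h_def k_def algebra_simps)
  ultimately have k: "k i = k j" for i j
    using periodic_arithmetic_progression_constant[of "2 * m" k "a - m" 0] cop(1) \<open>m > 0\<close> by simp
  \<comment> \<open>Constancy of \<open>k\<close> yields only a constant increment of
    \<open>z\<close>. Periodicity forces this increment to be 0, which is why the progression lemma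
    allows a summand \<open>c\<close>.\<close>
  have "z (j + (b - m)) = z j + k 0" for j
    using k[of 0 "j - m"] by (simp add: k_def algebra_simps)
  then have z: "z j = z 0" for j
    using periodic_arithmetic_progression_constant[of "2 * m" z "b - m"] pz cop(2) \<open>m > 0\<close> by simp
  \<comment> \<open>As \<open>z\<close> is constant, (p + q) y is the constant \<open>- z 0\<close>;
    adding \<open>z 0 / 2\<close> to \<open>y\<close> makes the equation homogeneous.\<close>
  have "y j + z 0 / 2 = 0"
  proof (rule vanish[where f = "\<lambda>j. y j + z 0 / 2"])
    show "y (j + a) + z 0 / 2 + (y (j + b) + z 0 / 2) = 0" for j
      using eq(1)[of j] z[of j] by simp
  qed (use py in \<open>simp add: periodic_def\<close>)
  moreover have "x j + z 0 / 2 = 0"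
  proof (rule vanish[where f = "\<lambda>j. x j + z 0 / 2"])
    show "x (j + a) + z 0 / 2 + (x (j + b) + z 0 / 2) = 0" for j
      using eq(2)[of "j + a + b"] z[of "j + a + b"] by (simp add: algebra_simps)
  qed (use px in \<open>simp add: periodic_def\<close>)
  ultimately show ?thesis
    using z[of j] by simp
qed

text \<open>If 2^r is the exact power of 2 in \<open>b - a\<close> and \<open>r < v\<close>, then
  \<open>b - a\<close> is an odd and \<open>2 * m\<close> an even multiple of 2^r. A square wave
  changing sign every 2^r places is thus killed by p + q and \<open>2 * m\<close>-periodic, and (f,
  -f, 0) solves the system.\<close>

lemma kernel_triple_alternating:
  assumes n: "2 * m = 2 ^ v * w" and "\<not> 2 ^ v dvd b - a" and "b \<noteq> a"
  obtains x y z where "kernel_triple m a b x y z" "x (b - a) \<noteq> x 0"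
proof -
  obtain u where u: "b - a = 2 ^ multiplicity 2 (b - a) * u" "odd u"
    using multiplicity_decompose'[of "b - a" 2] \<open>b \<noteq> a\<close> by auto
  define r where "r = multiplicity 2 (b - a)"
  have "r < v"
  proof (rule ccontr)
    assume "\<not> r < v"
    then have "2 ^ v dvd (2::int) ^ r"
      by (intro le_imp_power_dvd) simp
    then show False
      using assms(2) u(1) unfolding r_def by (metis dvd_mult2)
  qed
  then obtain s where "v = Suc (r + s)"
    using less_imp_Suc_add by blast
  then have n': "2 * m = 2 ^ r * (2 * (2 ^ s * w))"
    by (simp add: n power_add)
  define f :: "int \<Rightarrow> real" where "f j = (if even (j div 2 ^ r) then 1 else -1)" for j
  have f_add: "f (j + 2 ^ r * k) = (if even k then f j else - f j)" for j k
    by (simp add: f_def)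
  have anti: "f (j + (b - a)) = - f j" for j
    using f_add[of j u] u by (simp add: r_def)
  have per: "f (j + 2 * m) = f j" for j
    unfolding n' f_add by simp
  have "- f (j + a) - f (j + b) = 0" "f (j - a) + f (j - b) = 0" for j
    using anti[of "j + a"] anti[of "j - b"] by simp_all
  then have "kernel_triple m a b f (\<lambda>j. - f j) (\<lambda>j. 0)"
    using per by (simp add: kernel_triple_def periodic_def)
  moreover have "f (b - a) \<noteq> f 0"
    using anti[of 0] by (simp add: f_def)
  ultimately show ?thesis
    using that by blast
qed

text \<open>A common divisor \<open>d\<close> of \<open>2 * m\<close> and \<open>a - m\<close> that
  is not a unit makes the indicator of the multiples of \<open>d\<close> a nonconstant sequence
  killed by p - E. Evenness of \<open>b - a\<close> keeps the resulting \<open>x\<close>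
  nonconstant.\<close>

lemma kernel_triple_divisor:
  assumes "d dvd 2 * m" "d dvd a - m" "\<not> d dvd 1" "even (b - a)"
  obtains x y z i j where "kernel_triple m a b x y z" "x i \<noteq> x j"
proof -
  define f :: "int \<Rightarrow> real" where "f j = of_bool (d dvd j)" for j
  have cong: "f i = f j" if "d dvd i - j" for i j
    using dvd_add_right_iff[OF that, of j] by (simp add: f_def)
  \<comment> \<open>\<open>E f = p f\<close>, so \<open>x = - (p + q) f\<close>, \<open>y = - (1/p + 1/q) f\<close> and
    \<open>z = (p + q) (1/p + 1/q) f\<close> solve the kernel equations.\<close>
  define x where "x j = - (f (j + a) + f (j + b))" for j
  define y where "y j = - (f (j - a) + f (j - b))" for j
  define z where "z j = 2 * f j + f (j + a - b) + f (j + b - a)" for j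
  have per: "f (j + 2 * m) = f j" for j
    using assms(1) by (intro cong) simp
  have am: "d dvd a + m"
    using dvd_add[OF assms(1,2)] by (simp add: add.commute)
  have rel: "f (j + a) = f (j + m)" "f (j - a) = f (j + m)"
    "f (j + m + a - b) = f (j - b)" "f (j + m + b - a) = f (j + b)" for j
  proof -
    have "f (j + a) = f (j + m)" "f (j + m) = f (j - a)"
      "f (j + m + a - b) = f (j - b)" "f (j + b) = f (j + m + b - a)"
      using assms(2) am by (intro cong; simp add: algebra_simps)+
    then show "f (j + a) = f (j + m)" "f (j - a) = f (j + m)"
      "f (j + m + a - b) = f (j - b)" "f (j + m + b - a) = f (j + b)"
      by simp_all
  qed
  have "kernel_triple m a b x y z"
    unfolding kernel_triple_def
  proof (intro conjI allI)
    show "periodic (2 * m) x"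
      using per[of "j + a" for j] per[of "j + b" for j] by (simp add: periodic_def x_def add_ac)
    show "periodic (2 * m) y"
      using per[of "j - a" for j] per[of "j - b" for j] by (simp add: periodic_def y_def algebra_simps)
    show "periodic (2 * m) z"
      using per per[of "j + a - b" for j] per[of "j + b - a" for j]
      by (simp add: periodic_def z_def algebra_simps)
  next
    fix j
    show "y (j + a) + y (j + b) + z j = 0" "x (j - a) + x (j - b) + z j = 0"
      by (simp_all add: x_def y_def z_def algebra_simps)
    show "x j + y j + z (j + m) = 0"
      using rel[of j] by (simp add: x_def y_def z_def)
  qed
  \<comment> \<open>Three consecutive arguments suffice. If \<open>x\<close> agreed there, it would
    be nonzero at all of them, so \<open>d\<close> would divide \<open>b - a + 1\<close> and also 2
    or \<open>b - a + 2\<close>. With \<open>b - a\<close> even, either case makes \<open>d\<close>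
    a unit.\<close>
  moreover have "x (- a) \<noteq> x (1 - a) \<or> x (- a) \<noteq> x (2 - a)"
  proof (rule ccontr)
    assume "\<not> ?thesis"
    moreover have "x (- a) \<noteq> 0"
      by (simp add: x_def f_def)
    ultimately have "x (1 - a) \<noteq> 0" "x (2 - a) \<noteq> 0"
      by simp_all
    then have "d dvd 1 \<or> d dvd 1 - a + b" "d dvd 2 \<or> d dvd 2 - a + b"
      unfolding x_def f_def by (auto simp: of_bool_def split: if_splits)
    then have "d dvd b - a + 1" "d dvd 2 \<or> d dvd b - a + 2"
      using assms(3) by (simp_all add: algebra_simps)
    moreover have "d dvd b - a + 2 \<Longrightarrow> d dvd 1" if "d dvd b - a + 1"
      using dvd_diff[of d "b - a + 2" "b - a + 1"] that by simp
    ultimately have "d dvd 2" "d dvd b - a + 1"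
      using assms(3) by auto
    moreover obtain q where "b - a = 2 * q"
      using assms(4) by blast
    ultimately have "d dvd (b - a + 1) - 2 * q"
      by (intro dvd_diff) auto
    then show False
      using assms(3) \<open>b - a = 2 * q\<close> by simp
  qed
  ultimately show ?thesis
    using that by blast
qed

section \<open>From the graph to the system of sequences\<close>

lemma mod_of_less_double:
  fixes k n :: nat
  assumes "k < 2 * n"
  shows "k mod n = (if k < n then k else k - n)"
  using assms by (simp add: le_mod_geq)

lemma vertices_T1: "j < n \<Longrightarrow> {X j, Y j, Z j} \<subseteq> fst (T1 n a b)"
  by (auto simp: T1_def)

text \<open>Only the edges between \<open>Z\<close> vertices could be loops, and the shift by n/2
  fixes no residue because 0 < n/2 < n.\<close>

lemma simple_graph_T1:
  assumes "even n" and "a < n"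
  shows "simple_graph (T1 n a b)"
proof -
  let ?V = "fst (T1 n a b)"
  let ?E = "{{u, v} | u v. u \<in> ?V \<and> v \<in> ?V \<and> u \<noteq> v}"
  obtain m where m: "n = 2 * m" "m > 0"
    using assms by (auto elim!: evenE)
  have loopless: "j \<noteq> (j + n div 2) mod n" if "j < n" for j
  proof -
    have "(j + m) mod n = (if j + m < n then j + m else j + m - n)"
      using that m by (intro mod_of_less_double) simp
    then have "(j + m) mod n \<noteq> j"
      using that m by (simp split: if_splits)
    then show ?thesis
      using m by simp
  qed
  have edge: "{u, v} \<in> ?E" if "u \<in> ?V" "v \<in> ?V" "u \<noteq> v" for u v
    using that by blast
  have "{{X j, Y ((j + a) mod n)}, {X j, Y ((j + b) mod n)}, {X j, Z j}, {Y j, Z j},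
      {Z j, Z ((j + n div 2) mod n)}} \<subseteq> ?E" if "j < n" for j
  proof -
    have "{X j, Y j, Z j, Y ((j + a) mod n), Y ((j + b) mod n), Z ((j + n div 2) mod n)} \<subseteq> ?V"
      using vertices_T1[of _ n a b] that assms(2) by (metis insert_subset mod_less_divisor neq0_conv not_less_zero empty_subsetI)
    then show ?thesis
      using loopless[OF that] by (intro insert_subsetI edge) simp_all
  qed
  then have "snd (T1 n a b) \<subseteq> ?E"
    unfolding T1_def snd_conv by (intro UN_least) (simp add: T1_def)
  then show ?thesis
    unfolding simple_graph_def by (simp add: T1_def)
qed

context
  fixes n a b :: nat
  assumes n: "even n" "a < n" "b < n" "a \<noteq> b"
begin

text \<open>The shift by \<open>n - c\<close> inverts the shift by \<open>c\<close>; this form of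
  subtraction stays within the natural numbers.\<close>

lemma add_mod_eq_iff:
  assumes "j < n" "k < n" "c < n"
  shows "j = (k + c) mod n \<longleftrightarrow> k = (j + (n - c)) mod n"
proof -
  obtain e where e: "n = c + e"
    using assms(3) less_imp_add_positive by blast
  have 1: "(k + c) mod n = (if k + c < n then k + c else k + c - n)"
    using assms by (intro mod_of_less_double) simp
  have 2: "(j + (n - c)) mod n = (if j + e < n then j + e else j + e - n)"
    using assms e mod_of_less_double[of "j + e" n] by simp
  show ?thesis
    unfolding 1 2 using assms e
    by (cases "k + c < n"; cases "j + e < n") (simp_all only: if_True if_False, linarith+)
qed

lemma add_half_mod_eq_iff:
  assumes "j < n" "k < n"
  shows "j = (k + n div 2) mod n \<longleftrightarrow> k = (j + n div 2) mod n"
proof -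
  obtain m where "n = 2 * m"
    using n(1) by blast
  then show ?thesis
    using add_mod_eq_iff[OF assms, of m] assms(1) by simp
qed

text \<open>The edges are listed from the side of \<open>X\<close>, so the neighbours of
  \<open>Y j\<close> come from inverting the shifts by \<open>a\<close> and \<open>b\<close>. An
  edge between \<open>Z\<close> vertices is met from both ends, but the shift by n/2 is its own
  inverse, so only one such neighbour results.\<close>

lemma neighbours_T1:
  assumes "j < n"
  shows "{u \<in> fst (T1 n a b). {X j, u} \<in> snd (T1 n a b)} =
      {Y ((j + a) mod n), Y ((j + b) mod n), Z j}"
    and "{u \<in> fst (T1 n a b). {Y j, u} \<in> snd (T1 n a b)} =
      {X ((j + (n - a)) mod n), X ((j + (n - b)) mod n), Z j}"
    and "{u \<in> fst (T1 n a b). {Z j, u} \<in> snd (T1 n a b)} =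
      {X j, Y j, Z ((j + n div 2) mod n)}"
proof -
  have res: "(i + c) mod n < n" for i c
    using n(2) by simp
  have "{X j, u} \<in> snd (T1 n a b) \<longleftrightarrow> u \<in> {Y ((j + a) mod n), Y ((j + b) mod n), Z j}" for u
    using assms by (auto simp: T1_def doubleton_eq_iff)
  then show "{u \<in> fst (T1 n a b). {X j, u} \<in> snd (T1 n a b)} =
      {Y ((j + a) mod n), Y ((j + b) mod n), Z j}"
    using vertices_T1[OF assms] vertices_T1[OF res] by auto
  have "{Y j, u} \<in> snd (T1 n a b) \<longleftrightarrow>
      (\<exists>k<n. (j = (k + a) mod n \<or> j = (k + b) mod n) \<and> u = X k) \<or> u = Z j" for u
    using assms by (auto simp: T1_def doubleton_eq_iff)
  moreover have "(\<exists>k<n. (j = (k + a) mod n \<or> j = (k + b) mod n) \<and> u = X k) \<longleftrightarrow>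
      (\<exists>k<n. (k = (j + (n - a)) mod n \<or> k = (j + (n - b)) mod n) \<and> u = X k)" for u
    by (intro ex_cong1 conj_cong refl)
      (simp only: add_mod_eq_iff[OF assms _ n(2)] add_mod_eq_iff[OF assms _ n(3)])
  ultimately have "{Y j, u} \<in> snd (T1 n a b) \<longleftrightarrow> u \<in> {X ((j + (n - a)) mod n), X ((j + (n - b)) mod n), Z j}" for u
    using res by auto
  then show "{u \<in> fst (T1 n a b). {Y j, u} \<in> snd (T1 n a b)} =
      {X ((j + (n - a)) mod n), X ((j + (n - b)) mod n), Z j}"
    using vertices_T1[OF assms] vertices_T1[OF res] by auto
  have "{Z j, u} \<in> snd (T1 n a b) \<longleftrightarrow> u = X j \<or> u = Y j \<or> u = Z ((j + n div 2) mod n) \<or>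
      (\<exists>k<n. j = (k + n div 2) mod n \<and> u = Z k)" for u
    using assms by (auto simp: T1_def doubleton_eq_iff)
  moreover have "(\<exists>k<n. j = (k + n div 2) mod n \<and> u = Z k) \<longleftrightarrow>
      (\<exists>k<n. k = (j + n div 2) mod n \<and> u = Z k)" for u
    by (intro ex_cong1 conj_cong refl) (rule add_half_mod_eq_iff[OF assms])
  ultimately have "{Z j, u} \<in> snd (T1 n a b) \<longleftrightarrow> u \<in> {X j, Y j, Z ((j + n div 2) mod n)}" for u
    using res by auto
  then show "{u \<in> fst (T1 n a b). {Z j, u} \<in> snd (T1 n a b)} =
      {X j, Y j, Z ((j + n div 2) mod n)}"
    using vertices_T1[OF assms] vertices_T1[OF res] by auto
qed

text \<open>The neighbour sets have to be sums of three separate terms; \<open>a \<noteq> b\<close>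
  ensures that the two shifted neighbours do not coincide.\<close>

lemma kernel_function_T1_iff_residues:
  "kernel_function (T1 n a b) f \<longleftrightarrow>
    (\<forall>j<n. f (Y ((j + a) mod n)) + f (Y ((j + b) mod n)) + f (Z j) = 0 \<and>
      f (X ((j + (n - a)) mod n)) + f (X ((j + (n - b)) mod n)) + f (Z j) = 0 \<and>
      f (X j) + f (Y j) + f (Z ((j + n div 2) mod n)) = 0)"
proof -
  have forward: "(j + a) mod n \<noteq> (j + b) mod n" for j
    using n cong_add_lcancel_nat[of j a b n] cong_less_modulus_unique_nat[of a b n]
    by (auto simp: cong_def)
  moreover have "(j + (n - a)) mod n \<noteq> (j + (n - b)) mod n" if "j < n" for j
  proof
    define k where "k = (j + (n - a)) mod n"
    assume "(j + (n - a)) mod n = (j + (n - b)) mod n"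
    then have k: "k = (j + (n - a)) mod n" "k = (j + (n - b)) mod n"
      by (simp_all add: k_def)
    have "k < n"
      using n(2) by (simp add: k_def)
    then have "j = (k + a) mod n" "j = (k + b) mod n"
      using k add_mod_eq_iff[OF that _ n(2)] add_mod_eq_iff[OF that _ n(3)] by blast+
    then show False
      using forward[of k] by simp
  qed
  ultimately have sums: "j < n \<Longrightarrow> sum f {u \<in> fst (T1 n a b). {X j, u} \<in> snd (T1 n a b)} =
      f (Y ((j + a) mod n)) + f (Y ((j + b) mod n)) + f (Z j)"
    "j < n \<Longrightarrow> sum f {u \<in> fst (T1 n a b). {Y j, u} \<in> snd (T1 n a b)} =
      f (X ((j + (n - a)) mod n)) + f (X ((j + (n - b)) mod n)) + f (Z j)"
    "j < n \<Longrightarrow> sum f {u \<in> fst (T1 n a b). {Z j, u} \<in> snd (T1 n a b)} =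
      f (X j) + f (Y j) + f (Z ((j + n div 2) mod n))" for j
    by (simp_all only: neighbours_T1) (simp_all add: add.assoc)
  have "fst (T1 n a b) = (\<Union>j<n. {X j, Y j, Z j})"
    by (simp add: T1_def)
  then have "kernel_function (T1 n a b) f \<longleftrightarrow>
      (\<forall>j\<in>{..<n}. \<forall>v\<in>{X j, Y j, Z j}. sum f {u \<in> fst (T1 n a b). {v, u} \<in> snd (T1 n a b)} = 0)"
    unfolding kernel_function_def by (simp only: ball_UN)
  then show ?thesis
    by (simp add: sums) (simp add: Ball_def)
qed

text \<open>Reducing the index modulo \<open>n\<close> extends a function on residues to periodic
  sequences, and an equation for all integers is one for all residues.\<close>

lemma kernel_function_T1_iff_triple:
  "kernel_function (T1 n a b) f \<longleftrightarrow>
    kernel_triple (int (n div 2)) (int a) (int b) (\<lambda>j. f (X (nat (j mod int n))))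
      (\<lambda>j. f (Y (nat (j mod int n)))) (\<lambda>j. f (Z (nat (j mod int n))))"
    (is "_ \<longleftrightarrow> kernel_triple ?m ?a ?b ?x ?y ?z")
proof -
  have m: "2 * ?m = int n"
    using n(1) by auto
  have periodic: "periodic (2 * ?m) ?x" "periodic (2 * ?m) ?y" "periodic (2 * ?m) ?z"
    unfolding m by (simp_all add: periodic_def)
  have residue: "nat ((j + int c) mod int n) = (nat (j mod int n) + c) mod n"
    "c \<le> n \<Longrightarrow> nat ((j - int c) mod int n) = (nat (j mod int n) + (n - c)) mod n" for j c
  proof -
    have "int ((nat (j mod int n) + d) mod n) = (j + int d) mod int n" for d
      using n by (simp add: zmod_int mod_simps)
    note * = this[THEN arg_cong, of nat, unfolded nat_int, symmetric]
    show "nat ((j + int c) mod int n) = (nat (j mod int n) + c) mod n"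
      by (rule *)
    show "nat ((j - int c) mod int n) = (nat (j mod int n) + (n - c)) mod n" if "c \<le> n"
    proof -
      have "(j + int (n - c)) mod int n = (j - int c + int n) mod int n"
        using that by (simp add: of_nat_diff algebra_simps)
      then show ?thesis
        using *[of "n - c"] by simp
    qed
  qed
  have all_residues: "(\<forall>j. P (nat (j mod int n))) \<longleftrightarrow> (\<forall>j<n. P j)" for P
  proof
    assume *: "\<forall>j. P (nat (j mod int n))"
    show "\<forall>j<n. P j"
    proof (intro allI impI)
      fix j assume "j < n"
      then show "P j" using *[rule_format, of "int j"] by simp
    qed
  next
    assume "\<forall>j<n. P j"
    moreover have "nat (j mod int n) < n" for j
      using n by (simp add: nat_less_iff)
    ultimately show "\<forall>j. P (nat (j mod int n))" by blast
  qed
  have "a \<le> n" "b \<le> n"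
    using n by auto
  then show ?thesis
    unfolding kernel_function_T1_iff_residues kernel_triple_def
    using periodic by (simp add: residue flip: all_residues) blast
qed

lemma kernel_function_T1_of_triple:
  assumes "kernel_triple (int (n div 2)) (int a) (int b) x y z"
  shows "kernel_function (T1 n a b)
    (\<lambda>v. case v of X j \<Rightarrow> x (int j) | Y j \<Rightarrow> y (int j) | Z j \<Rightarrow> z (int j))"
proof -
  have m: "2 * int (n div 2) = int n"
    using n(1) by auto
  have "periodic (int n) x" "periodic (int n) y" "periodic (int n) z"
    using assms unfolding kernel_triple_def m by simp_all
  then show ?thesis
    using n assms unfolding kernel_function_T1_iff_triple
    by (simp add: periodic_mod)
qed

text \<open>The constant vector (1, 1, -2) is always in the kernel and has no zero entry. The graph
  is therefore a nut graph exactly when this vector spans the kernel; its entry -2 at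
  \<open>Z 0\<close> fixes the factor as \<open>- z 0 / 2\<close>.\<close>

lemma nut_graph_T1_iff:
  "nut_graph (T1 n a b) \<longleftrightarrow>
    (\<forall>x y z. kernel_triple (int (n div 2)) (int a) (int b) x y z \<longrightarrow>
      (\<forall>j. x j = - z 0 / 2 \<and> y j = - z 0 / 2 \<and> z j = z 0))"
proof -
  let ?V = "fst (T1 n a b)"
  let ?K = "kernel_triple (int (n div 2)) (int a) (int b)"
  define h :: "T1_vertex \<Rightarrow> real" where "h v = (case v of X j \<Rightarrow> 1 | Y j \<Rightarrow> 1 | Z j \<Rightarrow> - 2)" for v
  have V: "X j \<in> ?V" "Y j \<in> ?V" "Z j \<in> ?V" if "j < n" for j
    using that by (auto simp: T1_def)
  have nonempty: "?V \<noteq> {}"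
    using V n(2) by blast
  have h: "kernel_function (T1 n a b) h"
    unfolding kernel_function_T1_iff_residues by (simp add: h_def)
  have h_nz: "h v \<noteq> 0" for v
    by (simp add: h_def split: T1_vertex.split)
  have m: "2 * int (n div 2) = int n"
    using n(1) by auto
  show ?thesis
    unfolding nut_graph_iff_kernel_function[OF simple_graph_T1[OF n(1,2)] nonempty]
  proof
    assume "\<exists>g. kernel_function (T1 n a b) g \<and> (\<forall>v\<in>?V. g v \<noteq> 0) \<and>
      (\<forall>f. kernel_function (T1 n a b) f \<longrightarrow> (\<exists>c. \<forall>v\<in>?V. f v = c * g v))"
    then obtain g where
      span: "\<And>f. kernel_function (T1 n a b) f \<Longrightarrow> \<exists>c. \<forall>v\<in>?V. f v = c * g v"
      by blast
    obtain c where c: "\<And>v. v \<in> ?V \<Longrightarrow> h v = c * g v"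
      using span[OF h] by blast
    show "\<forall>x y z. ?K x y z \<longrightarrow> (\<forall>j. x j = - z 0 / 2 \<and> y j = - z 0 / 2 \<and> z j = z 0)"
    proof (intro allI impI)
      fix x y z j
      assume K: "?K x y z"
      let ?f = "\<lambda>v. case v of X j \<Rightarrow> x (int j) | Y j \<Rightarrow> y (int j) | Z j \<Rightarrow> z (int j)"
      obtain d where d: "\<And>v. v \<in> ?V \<Longrightarrow> ?f v = d * g v"
        using span[OF kernel_function_T1_of_triple[OF K]] by blast
      \<comment> \<open>Since \<open>h\<close> is a nonzero multiple of the generator
        \<open>g\<close>, it can serve as generator itself.\<close>
      have "c \<noteq> 0"
        using c[of "X 0"] V(1)[of 0] h_nz[of "X 0"] n by auto
      have f: "?f v = d / c * h v" if "v \<in> ?V" for v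
        using c[OF that] d[OF that] \<open>c \<noteq> 0\<close> by simp
      define i where "i = nat (j mod int n)"
      have "i < n" "int i = j mod int n"
        using n by (simp_all add: i_def nat_less_iff)
      moreover have "periodic (int n) x" "periodic (int n) y" "periodic (int n) z"
        using K unfolding kernel_triple_def m by simp_all
      ultimately show "x j = - z 0 / 2 \<and> y j = - z 0 / 2 \<and> z j = z 0"
        using f[OF V(1), of i] f[OF V(2), of i] f[OF V(3), of i] f[OF V(3), of 0] n
        by (simp add: h_def periodic_mod)
    qed
  next
    assume *: "\<forall>x y z. ?K x y z \<longrightarrow> (\<forall>j. x j = - z 0 / 2 \<and> y j = - z 0 / 2 \<and> z j = z 0)"
    have "\<exists>c. \<forall>v\<in>?V. f v = c * h v" if f: "kernel_function (T1 n a b) f" for f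
    proof (intro exI ballI)
      fix v assume "v \<in> ?V"
      then obtain j where "j < n" "v = X j \<or> v = Y j \<or> v = Z j"
        by (auto simp: T1_def)
      then show "f v = - f (Z 0) / 2 * h v"
        using *[rule_format, OF f[unfolded kernel_function_T1_iff_triple], of "int j"]
        by (auto simp: h_def)
    qed
    then show "\<exists>g. kernel_function (T1 n a b) g \<and> (\<forall>v\<in>?V. g v \<noteq> 0) \<and>
      (\<forall>f. kernel_function (T1 n a b) f \<longrightarrow> (\<exists>c. \<forall>v\<in>?V. f v = c * g v))"
      using h h_nz by blast
  qed
qed

end

section \<open>The arithmetic conditions\<close>

text \<open>Coprimality to \<open>2 * m\<close> splits into coprimality to \<open>m\<close>, where
  \<open>a - m\<close> may be replaced by \<open>a\<close>, and to 2, which is a parity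
  condition.\<close>

lemma coprime_double_diff_iff:
  fixes m a :: nat
  shows "coprime (2 * int m) (int a - int m) \<longleftrightarrow> gcd m a = 1 \<and> \<not> [a = m] (mod 2)"
proof -
  have "coprime (int m) (int a - int m) \<longleftrightarrow> gcd m a = 1"
    using gcd_diff1[of "int a" "int m"] gcd_int_int_eq[of a m]
    by (simp add: coprime_iff_gcd_eq_1 gcd.commute)
  moreover have "coprime 2 (int a - int m) \<longleftrightarrow> \<not> [a = m] (mod 2)"
    by (simp add: cong_def) presburger
  ultimately show ?thesis
    by auto
qed

theorem theorem5p1:
  fixes n a b :: nat
  assumes "even n" and "a < n" and "b < n" and "a \<noteq> b"
  shows "nut_graph (T1 n a b) \<longleftrightarrow>
    (gcd (n div 2) a = 1 \<and> gcd (n div 2) b = 1) \<and>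
    (\<not> [a = n div 2] (mod 2) \<and> \<not> [b = n div 2] (mod 2)) \<and>
    multiplicity 2 (int b - int a) \<ge> multiplicity 2 n"
proof -
  define m v where "m = int (n div 2)" and "v = multiplicity 2 n"
  let ?cop = "\<lambda>c. coprime (2 * m) (int c - m)"
  let ?K = "kernel_triple m (int a) (int b)"
  obtain w where "n = 2 ^ v * w" "odd w"
    using multiplicity_decompose'[of n 2] assms(2) by (auto simp: v_def)
  moreover have "2 * m = int n"
    using assms(1) by (auto simp: m_def)
  ultimately have n: "2 * m = 2 ^ v * int w" "odd (int w)" and "v \<noteq> 0"
    using assms(1) by (auto intro!: Nat.gr0I)
  have val: "v \<le> multiplicity 2 (int b - int a) \<longleftrightarrow> 2 ^ v dvd int b - int a"
    using assms(4) by (subst power_dvd_iff_le_multiplicity) auto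
  have "m > 0"
    using assms by (auto simp: m_def elim!: evenE)
  have nut: "nut_graph (T1 n a b) \<longleftrightarrow>
      (\<forall>x y z. ?K x y z \<longrightarrow> (\<forall>j. x j = - z 0 / 2 \<and> y j = - z 0 / 2 \<and> z j = z 0))"
    unfolding m_def by (rule nut_graph_T1_iff[OF assms])
  have "nut_graph (T1 n a b) \<longleftrightarrow> ?cop a \<and> ?cop b \<and> 2 ^ v dvd int b - int a"
  proof
    assume "nut_graph (T1 n a b)"
    then have const: "x i = x j" if "?K x y z" for x y z i j
      using that unfolding nut by metis
    have dvd: "2 ^ v dvd int b - int a"
      using kernel_triple_alternating[OF n(1)] const assms(4) by (metis of_nat_eq_iff)
    \<comment> \<open>\<open>n\<close> is even, so \<open>v\<close> is at least 1 and the valuation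
      condition, already established, supplies the parity that \<open>kernel_triple_divisor\<close>
      asks for.\<close>
    then have even: "even (int b - int a)"
      using \<open>v \<noteq> 0\<close> by (meson dvd_power dvd_trans neq0_conv)
    \<comment> \<open>The system is symmetric in \<open>a\<close> and \<open>b\<close>, so the
      construction for a divisor of \<open>a - m\<close> serves for \<open>b - m\<close>
      too.\<close>
    have "?K = kernel_triple m (int b) (int a)"
      by (simp add: kernel_triple_def fun_eq_iff add_ac)
    then have "?cop c" if "c = a \<or> c = b" for c
      using that const even kernel_triple_divisor[of _ m "int c"]
      by (intro coprimeI) (metis dvd_diff_commute)
    then show "?cop a \<and> ?cop b \<and> 2 ^ v dvd int b - int a"
      using dvd by blast
  next
    assume "?cop a \<and> ?cop b \<and> 2 ^ v dvd int b - int a"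
    then show "nut_graph (T1 n a b)"
      unfolding nut using kernel_triple_determined[OF _ \<open>m > 0\<close> n] by blast
  qed
  then show ?thesis
    using val unfolding v_def m_def coprime_double_diff_iff by argo
qed

end
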